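(* Let $V$ be a finite set and let $A$ be a $V\times V$-matrix over $\mathrm{GF}(4)$ that is $\mathrm{inv}$-symmetric, i.e. $\mathrm{inv}(-A^T)=A$ (equivalently $\mathrm{inv}(A^T)=A$, as $-1=1$ in $\mathrm{GF}(4)$). Then $A$ is principally unimodular: for every $Y\subseteq V$, $\det(A[Y])\in\{0,1,-1\}$.
   Context: $\mathrm{inv}$ denotes the unique nontrivial field automorphism of $\mathrm{GF}(4)$, namely $x\mapsto x^2$ (so $\mathrm{inv}(x)=x^{-1}$ for $x\neq 0$); it is applied entrywise to matrices. Rows and columns of a $V\times V$-matrix are indexed by $V$ (unordered); $A[Y]$ denotes the principal submatrix with rows and columns indexed by $Y$, and $\det(A[\emptyset])=1$ by convention. *)

theory Defs
  imports "HOL-Analysis.Determinants"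
begin

text \<open>
  \<open>GF(4)\<close> is rendered as an arbitrary type \<open>'a :: field\<close> with \<open>CARD('a) = 4\<close>.
  A \<open>V \<times> V\<close>-matrix is a function \<open>A :: 'v \<Rightarrow> 'v \<Rightarrow> 'a\<close> of which only the values on
  \<open>V \<times> V\<close> matter; its principal submatrix \<open>A[Y]\<close> is the same function, read on \<open>Y \<times> Y\<close>.
\<close>

definition gf4_inv :: "'a::field \<Rightarrow> 'a" where
  "gf4_inv x = x ^ 2"

definition inv_symmetric :: "'v set \<Rightarrow> ('v \<Rightarrow> 'v \<Rightarrow> 'a::field) \<Rightarrow> bool" where
  "inv_symmetric V A \<longleftrightarrow> (\<forall>i\<in>V. \<forall>j\<in>V. gf4_inv (- A j i) = A i j)"

text \<open>
  \<open>pdet A Y\<close> is \<open>det(A[Y])\<close>. The library determinant is indexed by a whole type, so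
  its defining formula is repeated here for an index set.
\<close>

definition pdet :: "('v \<Rightarrow> 'v \<Rightarrow> 'a::comm_ring_1) \<Rightarrow> 'v set \<Rightarrow> 'a" where
  "pdet A Y = (\<Sum>p | p permutes Y. of_int (sign p) * (\<Prod>i\<in>Y. A i (p i)))"

lemma pdet_UNIV: "pdet (\<lambda>i j. M $ i $ j) UNIV = det M"
  by (simp add: pdet_def det_def)

lemma pdet_empty: "pdet A {} = 1"
  by (simp add: pdet_def)

definition principally_unimodular :: "'v set \<Rightarrow> ('v \<Rightarrow> 'v \<Rightarrow> 'a::comm_ring_1) \<Rightarrow> bool" where
  "principally_unimodular V A \<longleftrightarrow> (\<forall>Y\<subseteq>V. pdet A Y \<in> {0, 1, - 1})"

text \<open>
  A model, showing that fields with four elements exist as types: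
  \<open>GF4 a b\<close> stands for \<open>a + b\<omega>\<close> over \<open>GF(2)\<close> with \<open>\<omega>\<^sup>2 = \<omega> + 1\<close>.
\<close>

datatype gf4 = GF4 bool bool

instantiation gf4 :: field
begin

definition "0 = GF4 False False"
definition "1 = GF4 True False"

fun plus_gf4 where
  "GF4 a b + GF4 c d = GF4 (a \<noteq> c) (b \<noteq> d)"

fun times_gf4 where
  "GF4 a b * GF4 c d = GF4 ((a \<and> c) \<noteq> (b \<and> d)) (((a \<and> d) \<noteq> (b \<and> c)) \<noteq> (b \<and> d))"

definition "- (x::gf4) = x"
definition "(x::gf4) - y = x + y"
definition "inverse (x::gf4) = x * x"
definition "(x::gf4) div y = x * (y * y)"

instance
proof
  fix a b c :: gf4
  show "a * b * c = a * (b * c)" by (cases a; cases b; cases c) auto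
  show "a * b = b * a" by (cases a; cases b) auto
  show "1 * a = a" by (cases a) (auto simp: one_gf4_def)
  show "a + b + c = a + (b + c)" by (cases a; cases b; cases c) auto
  show "a + b = b + a" by (cases a; cases b) auto
  show "0 + a = a" by (cases a) (auto simp: zero_gf4_def)
  show "- a + a = 0" by (cases a) (auto simp: zero_gf4_def uminus_gf4_def)
  show "a - b = a + - b" by (simp add: minus_gf4_def uminus_gf4_def)
  show "(a + b) * c = a * c + b * c" by (cases a; cases b; cases c) auto
  show "(0::gf4) \<noteq> 1" by (simp add: zero_gf4_def one_gf4_def)
  show "a \<noteq> 0 \<Longrightarrow> inverse a * a = 1"
    by (cases a) (auto simp: zero_gf4_def one_gf4_def inverse_gf4_def)
  show "a div b = a * inverse b" by (simp add: divide_gf4_def inverse_gf4_def)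
  show "inverse (0::gf4) = 0" by (simp add: zero_gf4_def inverse_gf4_def)
qed

end

lemma CARD_gf4: "CARD(gf4) = 4"
proof -
  have "(UNIV :: gf4 set) = (\<lambda>(a, b). GF4 a b) ` UNIV"
    by (auto simp: image_iff split: prod.splits) (metis gf4.exhaust)
  moreover have "inj (\<lambda>(a, b). GF4 a b)" by (auto simp: inj_def)
  ultimately have "CARD(gf4) = CARD(bool \<times> bool)" by (metis card_image)
  then show ?thesis by simp
qed

end

theory Submission imports Defs begin

text \<open>
  Squaring is a ring endomorphism in characteristic 2, so squaring \<open>det(A[Y])\<close> squares every
  entry. For an \<open>inv\<close>-symmetric matrix this is transposition, which fixes the determinant.
  Hence \<open>det(A[Y])\<close> is idempotent, and the only idempotents of a field are 0 and 1.
\<close>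

text \<open>Translation by 1 permutes the ring, so adding 1 to every term leaves the sum of all
  elements unchanged; cancelling that sum leaves \<open>CARD('a)\<close> copies of 1.\<close>

lemma of_nat_CARD_eq_0:
  assumes "finite (UNIV :: 'a::comm_ring_1 set)"
  shows "of_nat CARD('a) = (0::'a)"
proof -
  have "(\<Sum>x\<in>UNIV. x) = (\<Sum>x\<in>UNIV. x + (1::'a))"
    by (rule sum.reindex_bij_witness[where i = "\<lambda>x. x + 1" and j = "\<lambda>x. x - 1"]) auto
  then show ?thesis
    by (simp add: sum.distrib)
qed

lemma CARD_4_imp_2_eq_0:
  assumes "CARD('a::field) = 4"
  shows "(2::'a) = 0"
proof -
  have "finite (UNIV :: 'a set)"
    using assms by (simp add: card_ge_0_finite)
  \<comment> \<open>4 is factored as 2 * 2 so that the absence of zero divisors gives 2 = 0.\<close>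
  from of_nat_CARD_eq_0[OF this] have "(2::'a) * 2 = 0"
    using assms by simp
  then show ?thesis
    by (simp only: mult_eq_0_iff disj_absorb)
qed

lemma uminus_eq_self_char_2:
  assumes "(2::'a::comm_ring_1) = 0"
  shows "- x = (x::'a)"
proof -
  have "x + x = 0"
    using assms by (metis mult_2 mult_zero_left)
  then show ?thesis
    by (simp add: minus_unique)
qed

text \<open>The cross term 2xy in the square of x + y vanishes.\<close>

lemma sum_power2_char_2:
  fixes f :: "'b \<Rightarrow> 'a::comm_ring_1"
  assumes "(2::'a) = 0"
  shows "(\<Sum>x\<in>S. f x)\<^sup>2 = (\<Sum>x\<in>S. (f x)\<^sup>2)"
  by (induction S rule: infinite_finite_induct) (simp_all add: power2_sum assms)

text \<open>Reindex the sum by p \<mapsto> \<open>inv p\<close> (here the inverse function), which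
  preserves signs, then each product along p.\<close>

lemma pdet_transpose: "pdet (\<lambda>i j. A j i) Y = pdet A Y"
proof (cases "finite Y")
  case True
  have "of_int (sign (inv p)) * (\<Prod>i\<in>Y. A (inv p i) i) = of_int (sign p) * (\<Prod>i\<in>Y. A i (p i))"
    if p: "p permutes Y" for p
  proof -
    have "(\<Prod>i\<in>Y. A (inv p i) i) = (\<Prod>i\<in>Y. A i (p i))"
      using prod.permute[OF p, of "\<lambda>i. A (inv p i) i"] permutes_inverses(2)[OF p]
      by (simp add: o_def)
    then show ?thesis
      using p True by (simp add: sign_inverse permutation_permutes[THEN iffD2, OF exI])
  qed
  then show ?thesis
    unfolding pdet_def by (subst sum_permutations_inverse) (auto intro: sum.cong)
\<comment> \<open>For infinite Y every product is 1 by default, so the two sums coincide.\<close>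
qed (simp add: pdet_def)

text \<open>Since -1 = 1, the determinant is the permanent, and squaring need not deal with
  signs.\<close>

lemma pdet_char_2:
  fixes A :: "'v \<Rightarrow> 'v \<Rightarrow> 'a::comm_ring_1"
  assumes "(2::'a) = 0"
  shows "pdet A Y = (\<Sum>p | p permutes Y. \<Prod>i\<in>Y. A i (p i))"
  unfolding pdet_def
  by (intro sum.cong refl) (simp add: sign_def uminus_eq_self_char_2[OF assms])

lemma pdet_power2_char_2:
  fixes A :: "'v \<Rightarrow> 'v \<Rightarrow> 'a::comm_ring_1"
  assumes "(2::'a) = 0"
  shows "(pdet A Y)\<^sup>2 = pdet (\<lambda>i j. (A i j)\<^sup>2) Y"
  by (simp add: pdet_char_2[OF assms] sum_power2_char_2[OF assms] prod_power_distrib)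

text \<open>Needed because \<open>inv_symmetric\<close> constrains entries on V \<times> V only, so
  the squared and transposed matrices may differ as functions.\<close>

lemma pdet_cong:
  assumes "\<And>i j. i \<in> Y \<Longrightarrow> j \<in> Y \<Longrightarrow> A i j = B i j"
  shows "pdet A Y = pdet B Y"
  unfolding pdet_def using assms
  by (intro sum.cong refl arg_cong2[where f = "(*)"] prod.cong) (auto simp: permutes_in_image)

theorem theorem1:
  fixes V :: "'v set" and A :: "'v \<Rightarrow> 'v \<Rightarrow> 'a::field"
  assumes "CARD('a) = 4"
    and "finite V"
    and "inv_symmetric V A"
  shows "principally_unimodular V A"
  unfolding principally_unimodular_def
proof (intro allI impI)
  fix Y assume "Y \<subseteq> V"
  have two: "(2::'a) = 0"
    using assms(1) by (rule CARD_4_imp_2_eq_0)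
  have "(pdet A Y)\<^sup>2 = pdet (\<lambda>i j. (A i j)\<^sup>2) Y"
    using two by (rule pdet_power2_char_2)
  \<comment> \<open>The minus sign in \<open>inv_symmetric\<close> disappears under
    squaring.\<close>
  also have "\<dots> = pdet (\<lambda>i j. A j i) Y"
    using assms(3) \<open>Y \<subseteq> V\<close>
    by (intro pdet_cong) (auto simp: inv_symmetric_def gf4_inv_def)
  also have "\<dots> = pdet A Y"
    by (rule pdet_transpose)
  finally have "pdet A Y = 0 \<or> pdet A Y = 1"
    by (simp add: power2_eq_square)
  then show "pdet A Y \<in> {0, 1, - 1}"
    by auto
qed

end
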